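(* Let $p\ge0$, $q\ge0$, $m\ge0$ be integers and let $f,g,h$ be entire functions represented by vector valued Dirichlet series such that $f$ has relative index-pair $(m,q)$ and $g$ has relative index-pair $(m,p)$ with respect to $h$. Then $$\left[\frac{\tau_h^{(m,q)}(f)}{\overline{\tau}_h^{(m,p)}(g)}\right]^{\frac{1}{\lambda_h^{(m,p)}(g)}}\le\tau_g^{(p,q)}(f)\le\min\left\{\left[\frac{\tau_h^{(m,q)}(f)}{\overline{\Delta}_h^{(m,p)}(g)}\right]^{\frac{1}{\rho_h^{(m,p)}(g)}},\left[\frac{\overline{\tau}_h^{(m,q)}(f)}{\Delta_h^{(m,p)}(g)}\right]^{\frac{1}{\rho_h^{(m,p)}(g)}}\right\}.$$
   Context: VVDS: an entire function represented by a vector valued Dirichlet series is a function $f(s)=\sum_{n\ge1}a_ne^{s\lambda_n}$, $s=\sigma+it$, not identically zero, with $a_n$ in a complex Banach space $(E,\|\cdot\|)$, $0<\lambda_n<\lambda_{n+1}$, $\lambda_n\to+\infty$, $\limsup_{n}\frac{\log n}{\lambda_n}<+\infty$ and $\limsup_{n}\frac{\log\|a_n\|}{\lambda_n}=-\infty$ (so the series converges absolutely everywhere). Its maximum modulus is $M_f(\sigma)=\sup_{t\in\mathbb R}\|f(\sigma+it)\|$, and $M_f^{-1}$ is the inverse function of $M_f$. Iterated logarithms: $\log^{[0]}x=x$, $\log^{[-1]}x=\exp x$, $\log^{[k]}x=\log(\log^{[k-1]}x)$ for $k\ge1$. Index-pair: for $k\ge q+1\ge1$ let $\rho_f(k,q)=\limsup_{\sigma\to+\infty}\frac{\log^{[k]}M_f(\sigma)}{\log^{[q]}\sigma}$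 (the same formula is used for shifted indices). $f$ has index-pair $(1,1)$ if $0<\rho_f(1,1)<\infty$; otherwise $f$ has index-pair $(k,q)\neq(1,1)$, $k\ge q+1\ge1$, if $\delta_{k-q,0}<\rho_f(k,q)<\infty$ and $\rho_f(k-1,q-1)$ is not a positive real number, where $\delta_{i,j}=1$ if $i=j$ and $0$ otherwise. Relative Ritt orders: if $f$ and $g$ have index-pairs $(k,q)$ and $(k,p)$ with $k\ge q+1\ge1$, $k\ge p+1\ge1$, then $$\rho_g^{(p,q)}(f)=\limsup_{\sigma\to+\infty}\frac{\log^{[p]}M_g^{-1}(M_f(\sigma))}{\log^{[q]}\sigma},\qquad \lambda_g^{(p,q)}(f)=\liminf_{\sigma\to+\infty}\frac{\log^{[p]}M_g^{-1}(M_f(\sigma))}{\log^{[q]}\sigma}$$ are the $(p,q)$-th relative Ritt order and lower order of $f$ with respect to $g$. In this situation $f$ has relative index-pair $(p,q)$ with respect to $g$ if $b<\rho_g^{(p,q)}(f)<\infty$ and $\rho_g^{(p-1,q-1)}(f)$ (same formula) is not a nonzero finite number, where $b=1$ if $p=q=k$ and $b=0$ otherwise. Relative types: if $0<\rho_g^{(p,q)}(f)<\infty$, the relative Ritt type $\Delta_g^{(p,q)}(f)$ and lower type $\overline{\Delta}_g^{(p,q)}(f)$ are respectively the $\limsup$ and the $\liminf$ as $\sigma\to+\infty$ of $$\frac{\log^{[p-1]}M_g^{-1}(M_f(\sigma))}{[\log^{[q-1]}\sigma]^{\rho_g^{(p,q)}(f)}}.$$ If $0<\lambda_g^{(p,q)}(f)<\infty$,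 the relative Ritt weak type $\tau_g^{(p,q)}(f)$ and the indicator $\overline{\tau}_g^{(p,q)}(f)$ are respectively the $\liminf$ and the $\limsup$ as $\sigma\to+\infty$ of $$\frac{\log^{[p-1]}M_g^{-1}(M_f(\sigma))}{[\log^{[q-1]}\sigma]^{\lambda_g^{(p,q)}(f)}}.$$ For other pairs of functions and indices the definitions are the same with the letters changed. The claim presupposes that all quantities appearing in it are defined, i.e. the corresponding orders or lower orders are positive and finite. Convention: types lie in $[0,\infty]$; quotients are taken with $a/0=\infty$ for $a>0$ and $a/\infty=0$ for $a<\infty$, and relations are asserted when every quotient is meaningful (no $0/0$ or $\infty/\infty$). *)

theory Defs
  imports "HOL-Analysis.Analysis"
begin

text \<open>
  Complex Banach spaces: a real Banach space whose scalar multiplication and norm extend to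
  complex scalars.
\<close>

class complex_banach = banach +
  fixes scaleC :: "complex \<Rightarrow> 'a \<Rightarrow> 'a" (infixr \<open>*\<^sub>C\<close> 75)
  assumes scaleC_add_right: "c *\<^sub>C (x + y) = c *\<^sub>C x + c *\<^sub>C y"
    and scaleC_add_left: "(c + d) *\<^sub>C x = c *\<^sub>C x + d *\<^sub>C x"
    and scaleC_scaleC: "c *\<^sub>C d *\<^sub>C x = (c * d) *\<^sub>C x"
    and scaleC_of_real: "complex_of_real r *\<^sub>C x = r *\<^sub>R x"
    and norm_scaleC: "norm (c *\<^sub>C x) = cmod c * norm x"

text \<open>
  The coefficients and exponents are indexed from \<open>0\<close>, so \<open>a n\<close>, \<open>l n\<close> are the terms usually
  numbered \<open>n + 1\<close>; this is why \<open>Suc n\<close> occurs in the density condition. The conditional in the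
  last growth condition implements \<open>log 0 = -\<infinity>\<close>, since \<open>ln 0 = 0\<close> in HOL.
\<close>

definition vvds :: "(complex \<Rightarrow> 'a::complex_banach) \<Rightarrow> bool" where
  "vvds f \<longleftrightarrow>
     (\<exists>s. f s \<noteq> 0) \<and>
     (\<exists>(a :: nat \<Rightarrow> 'a) (l :: nat \<Rightarrow> real).
        (\<forall>n. 0 < l n \<and> l n < l (Suc n)) \<and>
        filterlim l at_top sequentially \<and>
        limsup (\<lambda>n. ereal (ln (real (Suc n)) / l n)) < \<infinity> \<and>
        limsup (\<lambda>n. if a n = 0 then - \<infinity> else ereal (ln (norm (a n)) / l n)) = - \<infinity> \<and>
        (\<forall>s. (\<lambda>n. exp (s * complex_of_real (l n)) *\<^sub>C a n) sums f s))"

text \<open>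
  For \<^term>\<open>vvds f\<close> the supremum is over a bounded set, and \<open>max_modulus f\<close> is a strictly
  increasing continuous bijection from the reals onto the positive reals, so
  \<^term>\<open>inv (max_modulus f)\<close> is its genuine inverse there.
\<close>

definition max_modulus :: "(complex \<Rightarrow> 'a::real_normed_vector) \<Rightarrow> real \<Rightarrow> real" where
  "max_modulus f \<sigma> = (SUP t. norm (f (Complex \<sigma> t)))"

definition iter_log :: "int \<Rightarrow> real \<Rightarrow> real" where
  "iter_log k = (if 0 \<le> k then ln ^^ nat k else exp ^^ nat (- k))"

definition ritt_order :: "(complex \<Rightarrow> 'a::complex_banach) \<Rightarrow> int \<Rightarrow> int \<Rightarrow> ereal" where
  "ritt_order f k q =
     Limsup at_top (\<lambda>\<sigma>. ereal (iter_log k (max_modulus f \<sigma>) / iter_log q \<sigma>))"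

definition index_pair :: "(complex \<Rightarrow> 'a::complex_banach) \<Rightarrow> int \<Rightarrow> int \<Rightarrow> bool" where
  "index_pair f k q \<longleftrightarrow>
     (if k = 1 \<and> q = 1 then 0 < ritt_order f 1 1 \<and> ritt_order f 1 1 < \<infinity>
      else \<not> (0 < ritt_order f 1 1 \<and> ritt_order f 1 1 < \<infinity>) \<and>
        k \<ge> q + 1 \<and> q + 1 \<ge> 1 \<and>
        (if k - q = 0 then 1 else 0) < ritt_order f k q \<and> ritt_order f k q < \<infinity> \<and>
        \<not> (0 < ritt_order f (k - 1) (q - 1) \<and> ritt_order f (k - 1) (q - 1) < \<infinity>))"

text \<open>In the relative notions the first argument \<open>g\<close> is the function compared with:
  \<open>rel_order g f p q\<close> is \<open>\<rho>\<^sub>g\<close> of \<open>f\<close> with superscript \<open>(p, q)\<close>.\<close>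

definition rel_modulus ::
    "(complex \<Rightarrow> 'a::complex_banach) \<Rightarrow> (complex \<Rightarrow> 'a) \<Rightarrow> real \<Rightarrow> real" where
  "rel_modulus g f \<sigma> = inv (max_modulus g) (max_modulus f \<sigma>)"

definition rel_order ::
    "(complex \<Rightarrow> 'a::complex_banach) \<Rightarrow> (complex \<Rightarrow> 'a) \<Rightarrow> int \<Rightarrow> int \<Rightarrow> ereal" where
  "rel_order g f p q =
     Limsup at_top (\<lambda>\<sigma>. ereal (iter_log p (rel_modulus g f \<sigma>) / iter_log q \<sigma>))"

definition rel_lower_order ::
    "(complex \<Rightarrow> 'a::complex_banach) \<Rightarrow> (complex \<Rightarrow> 'a) \<Rightarrow> int \<Rightarrow> int \<Rightarrow> ereal" where
  "rel_lower_order g f p q =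
     Liminf at_top (\<lambda>\<sigma>. ereal (iter_log p (rel_modulus g f \<sigma>) / iter_log q \<sigma>))"

definition rel_index_pair ::
    "(complex \<Rightarrow> 'a::complex_banach) \<Rightarrow> (complex \<Rightarrow> 'a) \<Rightarrow> int \<Rightarrow> int \<Rightarrow> bool" where
  "rel_index_pair g f p q \<longleftrightarrow>
     (\<exists>k. k \<ge> q + 1 \<and> q + 1 \<ge> 1 \<and> k \<ge> p + 1 \<and> p + 1 \<ge> 1 \<and>
        index_pair f k q \<and> index_pair g k p \<and>
        (if p = k \<and> q = k then 1 else 0) < rel_order g f p q \<and> rel_order g f p q < \<infinity> \<and>
        \<not> (rel_order g f (p - 1) (q - 1) \<noteq> 0 \<and> \<bar>rel_order g f (p - 1) (q - 1)\<bar> \<noteq> \<infinity>))"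

text \<open>
  The types and weak types below are meaningful only if the order (respectively the lower order)
  in the exponent is positive and finite; \<^const>\<open>real_of_ereal\<close> is then the identity.
\<close>

definition rel_type ::
    "(complex \<Rightarrow> 'a::complex_banach) \<Rightarrow> (complex \<Rightarrow> 'a) \<Rightarrow> int \<Rightarrow> int \<Rightarrow> ereal" where
  "rel_type g f p q =
     Limsup at_top (\<lambda>\<sigma>. ereal (iter_log (p - 1) (rel_modulus g f \<sigma>) /
       iter_log (q - 1) \<sigma> powr real_of_ereal (rel_order g f p q)))"

definition rel_lower_type ::
    "(complex \<Rightarrow> 'a::complex_banach) \<Rightarrow> (complex \<Rightarrow> 'a) \<Rightarrow> int \<Rightarrow> int \<Rightarrow> ereal" where
  "rel_lower_type g f p q =
     Liminf at_top (\<lambda>\<sigma>. ereal (iter_log (p - 1) (rel_modulus g f \<sigma>) /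
       iter_log (q - 1) \<sigma> powr real_of_ereal (rel_order g f p q)))"

text \<open>Here the unbarred \<open>\<tau>\<close> is the limit inferior and the indicator \<open>\<tau>\<close>-bar the limit superior.\<close>

definition rel_weak_type ::
    "(complex \<Rightarrow> 'a::complex_banach) \<Rightarrow> (complex \<Rightarrow> 'a) \<Rightarrow> int \<Rightarrow> int \<Rightarrow> ereal" where
  "rel_weak_type g f p q =
     Liminf at_top (\<lambda>\<sigma>. ereal (iter_log (p - 1) (rel_modulus g f \<sigma>) /
       iter_log (q - 1) \<sigma> powr real_of_ereal (rel_lower_order g f p q)))"

definition rel_weak_indicator ::
    "(complex \<Rightarrow> 'a::complex_banach) \<Rightarrow> (complex \<Rightarrow> 'a) \<Rightarrow> int \<Rightarrow> int \<Rightarrow> ereal" where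
  "rel_weak_indicator g f p q =
     Limsup at_top (\<lambda>\<sigma>. ereal (iter_log (p - 1) (rel_modulus g f \<sigma>) /
       iter_log (q - 1) \<sigma> powr real_of_ereal (rel_lower_order g f p q)))"

text \<open>
  Powers of elements of \<open>[0, \<infinity>]\<close> with positive real exponent. Division on \<^typ>\<open>ereal\<close> already
  satisfies \<open>a / 0 = \<infinity>\<close> for \<open>a > 0\<close> and \<open>a / \<infinity> = 0\<close>.
\<close>

definition ereal_powr :: "ereal \<Rightarrow> real \<Rightarrow> ereal" where
  "ereal_powr x c = (if x = \<infinity> then \<infinity> else ereal (real_of_ereal x powr c))"

definition quotient_meaningful :: "ereal \<Rightarrow> ereal \<Rightarrow> bool" where
  "quotient_meaningful a b \<longleftrightarrow> \<not> (a = 0 \<and> b = 0) \<and> \<not> (a = \<infinity> \<and> b = \<infinity>)"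

end

theory Submission
  imports Defs
begin

text \<open>
  With \<open>R = M\<^sub>g\<^sup>-\<^sup>1 \<circ> M\<^sub>f\<close> and \<open>G = M\<^sub>h\<^sup>-\<^sup>1 \<circ> M\<^sub>g\<close> one has \<open>M\<^sub>h\<^sup>-\<^sup>1 \<circ> M\<^sub>f = G \<circ> R\<close>, so growth estimates for
  \<open>G\<close> and \<open>G \<circ> R\<close> turn into growth estimates for \<open>R\<close>. These come with the exponents
  \<open>\<lambda>\<^sub>h(f) / \<lambda>\<^sub>h(g)\<close> and \<open>\<lambda>\<^sub>h(f) / \<rho>\<^sub>h(g)\<close> of \<open>log\<^sup>[\<^sup>q\<^sup>-\<^sup>1\<^sup>] \<sigma>\<close> instead of \<open>\<lambda>\<^sub>g(f)\<close>, and the inequalities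
  \<open>\<lambda>\<^sub>h(f) / \<rho>\<^sub>h(g) \<le> \<lambda>\<^sub>g(f) \<le> \<lambda>\<^sub>h(f) / \<lambda>\<^sub>h(g)\<close> go in the direction that each estimate needs.

  That \<open>M\<^sub>f\<close> is continuous, eventually strictly increasing and unbounded is shown without
  functionals or contour integrals: the mean of a Dirichlet series over four points around \<open>s\<close>
  makes its maximum modulus convex up to a small error, and a bounded convex function on a left half-line is
  nondecreasing.
\<close>

subsection \<open>Lower and upper limits of quotients\<close>

lemma frequently_less_of_Liminf_less:
  fixes c :: ereal
  assumes "Liminf F X < c"
  shows "frequently (\<lambda>x. X x < c) F"
proof (rule ccontr)
  assume "\<not> ?thesis"
  then have "eventually (\<lambda>x. c \<le> X x) F"
    by (simp add: frequently_def not_less)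
  from Liminf_bounded[OF this] assms show False by simp
qed

lemma frequently_less_of_less_Limsup:
  fixes c :: ereal
  assumes "c < Limsup F X"
  shows "frequently (\<lambda>x. c < X x) F"
proof (rule ccontr)
  assume "\<not> ?thesis"
  then have "eventually (\<lambda>x. X x \<le> c) F"
    by (simp add: frequently_def not_less)
  from Limsup_bounded[OF this] assms show False by simp
qed

text \<open>An upper bound for a lower limit needs only arbitrarily late witnesses; both upper
  bounds for the weak type end this way.\<close>

lemma Liminf_le_of_frequently:
  fixes c :: ereal
  assumes "frequently (\<lambda>x. X x \<le> c) F"
  shows "Liminf F X \<le> c"
proof (rule ccontr)
  assume "\<not> ?thesis"
  then have "eventually (\<lambda>x. c < X x) F" by (intro less_LiminfD) simp
  with assms have "frequently (\<lambda>x. X x \<le> c \<and> c < X x) F"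
    by (rule frequently_eventually_frequently)
  then show False by (simp add: not_le[symmetric] frequently_def)
qed

text \<open>A real \<beta> separates numerator from denominator, so that \<open>a\<close> and
  \<open>b\<close>, later limits, can be estimated independently. Take \<beta> = d / c with d
  strictly between c * b and \<open>a\<close>.\<close>

lemma less_quotient_separate:
  fixes a b :: ereal and c :: real
  assumes "0 \<le> a" "0 \<le> b" "quotient_meaningful a b" "0 < c" "ereal c < a / b"
  obtains \<beta> where "0 < \<beta>" "b < ereal \<beta>" "ereal (c * \<beta>) < a"
proof -
  \<comment> \<open>An infinite \<open>b\<close> forces \<open>a\<close> to be finite, and then a /
    b = 0 < c.\<close>
  obtain t where t: "b = ereal t" "0 \<le> t"
    using assms by (cases b) (auto simp: quotient_meaningful_def)
  have ct: "ereal (c * t) < a"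
  proof (cases "t = 0")
    case True
    then show ?thesis using assms t by (cases a) (auto simp: quotient_meaningful_def)
  next
    case False
    then show ?thesis using assms t by (cases a) (auto simp: field_simps)
  qed
  then obtain d where d: "ereal (c * t) < ereal d" "ereal d < a"
    using ereal_dense2 by blast
  have e: "c * t < d" using d(1) by simp
  show ?thesis
  proof (rule that[of "d / c"])
    have "0 \<le> c * t" using t assms(4) by simp
    with e show "0 < d / c" using assms(4) by simp
    show "b < ereal (d / c)" using e t assms(4) by (simp add: field_simps)
    show "ereal (c * (d / c)) < a" using d assms(4) by simp
  qed
qed

lemma quotient_less_separate:
  fixes a b :: ereal and c :: real
  assumes "0 \<le> a" "0 \<le> b" "quotient_meaningful a b" "0 < c" "a / b < ereal c"
  obtains \<beta> where "0 < \<beta>" "ereal \<beta> < b" "a < ereal (c * \<beta>)"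
proof -
  \<comment> \<open>If \<open>b\<close> were 0, then \<open>a\<close> would be positive and the
    quotient infinite.\<close>
  have b0: "b \<noteq> 0"
    using assms by (cases a) (auto simp: quotient_meaningful_def divide_ereal_def)
  obtain t where t: "a = ereal t" "0 \<le> t"
    using assms b0 by (cases a; cases b) (auto simp: quotient_meaningful_def)
  have "ereal (t / c) < b"
    using assms t b0 by (cases b) (auto simp: field_simps)
  then obtain d where d: "ereal (t / c) < ereal d" "ereal d < b"
    using ereal_dense2 by blast
  have e: "t / c < d" using d(1) by simp
  show ?thesis
  proof (rule that[of d])
    have "0 \<le> t / c" using t assms(4) by simp
    with e show "0 < d" by simp
    show "ereal d < b" by (rule d)
    show "a < ereal (c * d)" using e t assms(4) by (simp add: field_simps)
  qed
qed

text \<open>Replaces a possibly infinite \<open>X\<close> by real numbers c below it: if T were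
  smaller than the power, some d would lie strictly between, and c = d powr r gives a
  contradiction.\<close>

lemma ereal_powr_le:
  fixes X T :: ereal and r :: real
  assumes "0 < r" "0 \<le> X" "0 \<le> T"
    and lower: "\<And>c. \<lbrakk>0 < c; ereal c < X\<rbrakk> \<Longrightarrow> ereal (c powr (1 / r)) \<le> T"
  shows "ereal_powr X (1 / r) \<le> T"
proof (rule ccontr)
  assume "\<not> ?thesis"
  then have "T < ereal_powr X (1 / r)" by simp
  then obtain d where d: "T < ereal d" "ereal d < ereal_powr X (1 / r)"
    using ereal_dense2 by blast
  have d0: "0 < d" using d(1) assms(3) by (metis ereal_less(2) order_le_less_trans)
  have "ereal (d powr r) < X"
  proof (cases X)
    case (real x)
    then have x: "0 \<le> x" "d < x powr (1 / r)"
      using d(2) assms(2) by (auto simp: ereal_powr_def)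
    have "d powr r < (x powr (1 / r)) powr r"
      using x d0 assms(1) by (intro powr_less_mono2) auto
    then show ?thesis using real x(1) assms(1) by (simp add: powr_powr)
  qed (use assms(2) in auto)
  from lower[OF _ this] have "ereal ((d powr r) powr (1 / r)) \<le> T" using d0 by simp
  then show False using d(1) d0 assms(1) by (auto simp: powr_powr)
qed

lemma le_ereal_powr:
  fixes X T :: ereal and r :: real
  assumes "0 < r" "0 \<le> X"
    and upper: "\<And>c. \<lbrakk>0 < c; X < ereal c\<rbrakk> \<Longrightarrow> T \<le> ereal (c powr (1 / r))"
  shows "T \<le> ereal_powr X (1 / r)"
proof (cases X)
  case (real x)
  then have x: "0 \<le> x" using assms(2) by simp
  show ?thesis
  proof (rule ccontr)
    assume "\<not> ?thesis"
    then have "ereal (x powr (1 / r)) < T" using real by (simp add: ereal_powr_def)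
    then obtain d where d: "ereal (x powr (1 / r)) < ereal d" "ereal d < T"
      using ereal_dense2 by blast
    have d1: "x powr (1 / r) < d" using d(1) by simp
    have d0: "0 < d" by (rule le_less_trans[OF _ d1]) simp
    have "(x powr (1 / r)) powr r < d powr r"
      using d1 assms(1) by (intro powr_less_mono2) auto
    then have "x < d powr r" using x assms(1) by (simp add: powr_powr)
    then have "T \<le> ereal ((d powr r) powr (1 / r))"
      using upper[of "d powr r"] d0 real by simp
    then show False using d(2) d0 assms(1) by (auto simp: powr_powr)
  qed
qed (use assms(2) in \<open>auto simp: ereal_powr_def\<close>)

text \<open>Eliminating \<open>V\<close> from the last two hypotheses leaves c * S powr lf < W powr
  lg. Since S > 1, the exponent \<open>lf\<close> may be lowered to \<open>lg * l\<close>, and the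
  root of order \<open>lg\<close> gives the claim.\<close>

lemma quotient_ge_pointwise:
  fixes c \<beta> lf lg l :: real
  assumes "0 < c" "0 < \<beta>" "0 < lg" "lg * l \<le> lf" "1 < S" "1 < W"
    and "c * \<beta> < V / S powr lf" "V / W powr lg < \<beta>"
  shows "c powr (1 / lg) \<le> W / S powr l"
proof -
  have "c * \<beta> * S powr lf < V" "V < \<beta> * W powr lg"
    using assms by (simp_all add: pos_less_divide_eq pos_divide_less_eq)
  then have "\<beta> * (c * S powr lf) < \<beta> * W powr lg" by (simp add: mult_ac)
  then have "c * S powr lf < W powr lg" using assms by simp
  moreover have "c * S powr (lg * l) \<le> c * S powr lf"
    using assms by (intro mult_left_mono powr_mono) auto
  ultimately have "c * S powr (lg * l) \<le> W powr lg" by simp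
  then have "(c * S powr (lg * l)) powr (1 / lg) \<le> (W powr lg) powr (1 / lg)"
    using assms by (intro powr_mono2) auto
  then have "c powr (1 / lg) * S powr l \<le> W"
    using assms by (simp add: powr_mult powr_powr)
  then show ?thesis using assms by (simp add: pos_le_divide_eq)
qed

lemma quotient_le_pointwise:
  fixes c \<beta> lf rg l :: real
  assumes "0 < c" "0 < \<beta>" "0 < rg" "lf \<le> rg * l" "1 < S" "1 < W"
    and "V / S powr lf < c * \<beta>" "\<beta> < V / W powr rg"
  shows "W / S powr l \<le> c powr (1 / rg)"
proof -
  have "V < c * \<beta> * S powr lf" "\<beta> * W powr rg < V"
    using assms by (simp_all add: pos_less_divide_eq pos_divide_less_eq)
  then have "\<beta> * W powr rg < \<beta> * (c * S powr lf)" by (simp add: mult_ac)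
  then have "W powr rg < c * S powr lf" using assms by simp
  moreover have "c * S powr lf \<le> c * S powr (rg * l)"
    using assms by (intro mult_left_mono powr_mono) auto
  ultimately have "W powr rg \<le> c * S powr (rg * l)" by simp
  then have "(W powr rg) powr (1 / rg) \<le> (c * S powr (rg * l)) powr (1 / rg)"
    using assms by (intro powr_mono2) auto
  then have "W \<le> c powr (1 / rg) * S powr l"
    using assms by (simp add: powr_mult powr_powr)
  then show ?thesis using assms by (simp add: pos_divide_le_eq)
qed

section \<open>Orders and types of a composition\<close>

lemma Liminf_nonneg:
  fixes X :: "real \<Rightarrow> real"
  assumes "\<forall>\<^sub>F \<sigma> in at_top. 0 \<le> X \<sigma>"
  shows "0 \<le> Liminf at_top (\<lambda>\<sigma>. ereal (X \<sigma>))"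
  by (rule Liminf_bounded) (use assms in \<open>simp add: zero_ereal_def\<close>)

lemma Limsup_nonneg:
  fixes X :: "real \<Rightarrow> real"
  assumes "\<forall>\<^sub>F \<sigma> in at_top. 0 \<le> X \<sigma>"
  shows "0 \<le> Limsup at_top (\<lambda>\<sigma>. ereal (X \<sigma>))"
  using order_trans[OF Liminf_nonneg[OF assms] Liminf_le_Limsup] by simp

text \<open>Intended reading: \<open>s\<close>, \<open>w\<close> are the iterated logarithms with
  indices q - 1 and p - 1, \<open>R\<close> is the growth of f relative to g, and \<open>v\<close>
  is the iterated logarithm with index m - 1 of the growth of g relative to h. \<open>R_surj\<close>
  says that all large values of \<open>R\<close> are attained arbitrarily late.\<close>

locale growth_comparison =
  fixes s v w R :: "real \<Rightarrow> real"
  assumes s_top: "filterlim s at_top at_top"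
    and v_top: "filterlim v at_top at_top"
    and w_top: "filterlim w at_top at_top"
    and R_top: "filterlim R at_top at_top"
    and R_surj: "\<And>S. \<forall>\<^sub>F x in at_top. \<exists>\<sigma>\<ge>S. R \<sigma> = x"
begin

lemma eventually_R: "eventually P at_top \<Longrightarrow> \<forall>\<^sub>F \<sigma> in at_top. P (R \<sigma>)"
  using R_top by (simp add: filterlim_iff)

text \<open>Divergence of \<open>R\<close> transports only eventual properties: \<open>R\<close>
  might skip the points where P holds. \<open>R_surj\<close> rules this out.\<close>

lemma frequently_R:
  assumes "frequently P at_top"
  shows "\<exists>\<^sub>F \<sigma> in at_top. P (R \<sigma>)"
  unfolding frequently_def
proof
  assume "\<forall>\<^sub>F \<sigma> in at_top. \<not> P (R \<sigma>)"
  then obtain S where S: "\<And>\<sigma>. S \<le> \<sigma> \<Longrightarrow> \<not> P (R \<sigma>)"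
    by (auto simp: eventually_at_top_linorder)
  have "\<exists>\<^sub>F x in at_top. P x \<and> (\<exists>\<sigma>\<ge>S. R \<sigma> = x)"
    by (rule frequently_eventually_frequently[OF assms R_surj])
  then obtain x where "P x" "\<exists>\<sigma>\<ge>S. R \<sigma> = x"
    using frequently_ex by blast
  with S show False by blast
qed

lemma eventually_gt_one:
  "\<forall>\<^sub>F \<sigma> in at_top. 1 < s \<sigma> \<and> 1 < w (R \<sigma>) \<and> 1 < v (R \<sigma>)"
  using filterlim_at_top_dense[THEN iffD1, OF s_top, rule_format, of 1]
    eventually_R[OF filterlim_at_top_dense[THEN iffD1, OF w_top, rule_format, of 1]]
    eventually_R[OF filterlim_at_top_dense[THEN iffD1, OF v_top, rule_format, of 1]]
  by eventually_elim simp

text \<open>The quotient ln v / ln s factors through ln w, and a lower limit of a product of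
  positive factors is at least the product of the lower limits.\<close>

lemma lower_order_ge:
  fixes lf lg l :: real
  assumes lf: "Liminf at_top (\<lambda>\<sigma>. ereal (ln (v (R \<sigma>)) / ln (s \<sigma>))) = ereal lf"
    and lg: "Liminf at_top (\<lambda>x. ereal (ln (v x) / ln (w x))) = ereal lg"
    and l: "Liminf at_top (\<lambda>\<sigma>. ereal (ln (w (R \<sigma>)) / ln (s \<sigma>))) = ereal l"
    and pos: "0 < lf" "0 < lg"
  shows "lg * l \<le> lf"
proof (rule ccontr)
  assume "\<not> ?thesis"
  \<comment> \<open>The intermediate value k is split as (k / b) * b with k / b < lg and b < l, one
    factor for each quotient.\<close>
  then obtain k where k: "lf < k" "k < lg * l" using dense by (auto simp: not_le)
  then have "k / lg < l" using pos by (simp add: field_simps)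
  then obtain b where b: "k / lg < b" "b < l" using dense by blast
  have "0 < k / lg" using k pos by simp
  with b have b0: "0 < b" by simp
  have kb: "k / b < lg" using b b0 pos by (simp add: field_simps)
  have 1: "\<forall>\<^sub>F \<sigma> in at_top. k / b < ln (v (R \<sigma>)) / ln (w (R \<sigma>))"
    using eventually_R[OF less_LiminfD[of "ereal (k / b)" at_top "\<lambda>x. ereal (ln (v x) / ln (w x))"]] lg kb
    by simp
  have 2: "\<forall>\<^sub>F \<sigma> in at_top. b < ln (w (R \<sigma>)) / ln (s \<sigma>)"
    using less_LiminfD[of "ereal b" at_top "\<lambda>\<sigma>. ereal (ln (w (R \<sigma>)) / ln (s \<sigma>))"] l b by simp
  have "\<forall>\<^sub>F \<sigma> in at_top. ereal k \<le> ereal (ln (v (R \<sigma>)) / ln (s \<sigma>))"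
    using 1 2 eventually_gt_one
  proof eventually_elim
    case (elim \<sigma>)
    then have p: "0 < ln (s \<sigma>)" "0 < ln (w (R \<sigma>))" by simp_all
    have "k / b * ln (w (R \<sigma>)) < ln (v (R \<sigma>))" "b * ln (s \<sigma>) < ln (w (R \<sigma>))"
      using elim p by (simp_all add: pos_less_divide_eq)
    moreover from this(2) have "k / b * (b * ln (s \<sigma>)) \<le> k / b * ln (w (R \<sigma>))"
      using k pos b0 by (intro mult_left_mono) auto
    ultimately have "k * ln (s \<sigma>) \<le> ln (v (R \<sigma>))" using b0 by simp
    then show ?case using p by (simp add: pos_le_divide_eq)
  qed
  from Liminf_bounded[OF this] show False using lf k by simp
qed

text \<open>Same factorization, now with an upper limit for the first factor: it stays below its
  bound eventually, the second one only frequently, which suffices for a lower limit.\<close>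

lemma lower_order_le:
  fixes lf rg l :: real
  assumes lf: "Liminf at_top (\<lambda>\<sigma>. ereal (ln (v (R \<sigma>)) / ln (s \<sigma>))) = ereal lf"
    and rg: "Limsup at_top (\<lambda>x. ereal (ln (v x) / ln (w x))) = ereal rg"
    and l: "Liminf at_top (\<lambda>\<sigma>. ereal (ln (w (R \<sigma>)) / ln (s \<sigma>))) = ereal l"
    and pos: "0 < rg" "0 < l"
  shows "lf \<le> rg * l"
proof (rule ccontr)
  assume "\<not> ?thesis"
  then obtain k where k: "rg * l < k" "k < lf" using dense by (auto simp: not_le)
  then have "l < k / rg" using pos by (simp add: field_simps)
  then obtain b where b: "l < b" "b < k / rg" using dense by blast
  have b0: "0 < b" using b pos by simp
  have k0: "0 < k" by (rule less_trans[OF _ k(1)]) (use pos in simp)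
  have kb: "rg < k / b" using b b0 pos by (simp add: field_simps)
  have 1: "\<forall>\<^sub>F \<sigma> in at_top. ln (v (R \<sigma>)) / ln (w (R \<sigma>)) < k / b"
    using eventually_R[OF Limsup_lessD[of at_top "\<lambda>x. ereal (ln (v x) / ln (w x))" "ereal (k / b)"]] rg kb
    by simp
  have 2: "\<exists>\<^sub>F \<sigma> in at_top. ln (w (R \<sigma>)) / ln (s \<sigma>) < b"
    using frequently_less_of_Liminf_less[of at_top "\<lambda>\<sigma>. ereal (ln (w (R \<sigma>)) / ln (s \<sigma>))" "ereal b"] l b
    by simp
  have "\<exists>\<^sub>F \<sigma> in at_top. ereal (ln (v (R \<sigma>)) / ln (s \<sigma>)) \<le> ereal k"
    using frequently_eventually_frequently[OF 2 eventually_conj[OF 1 eventually_gt_one]]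
  proof (rule frequently_elim1)
    fix \<sigma> assume elim: "ln (w (R \<sigma>)) / ln (s \<sigma>) < b \<and>
      ln (v (R \<sigma>)) / ln (w (R \<sigma>)) < k / b \<and> 1 < s \<sigma> \<and> 1 < w (R \<sigma>) \<and> 1 < v (R \<sigma>)"
    then have p: "0 < ln (s \<sigma>)" "0 < ln (w (R \<sigma>))" by simp_all
    have "ln (v (R \<sigma>)) < k / b * ln (w (R \<sigma>))" "ln (w (R \<sigma>)) < b * ln (s \<sigma>)"
      using elim p by (simp_all only: pos_divide_less_eq)
    moreover from this(2) have "k / b * ln (w (R \<sigma>)) \<le> k / b * (b * ln (s \<sigma>))"
      using k0 b0 by (intro mult_left_mono) auto
    ultimately have "ln (v (R \<sigma>)) \<le> k * ln (s \<sigma>)" using b0 by simp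
    then show "ereal (ln (v (R \<sigma>)) / ln (s \<sigma>)) \<le> ereal k" using p by (simp add: pos_divide_le_eq)
  qed
  from Liminf_le_of_frequently[OF this] show False using lf k by simp
qed

lemma eventually_v_nonneg: "\<forall>\<^sub>F x in at_top. 0 \<le> v x"
  using v_top by (simp add: filterlim_at_top)

lemma types_nonneg:
  "0 \<le> Liminf at_top (\<lambda>\<sigma>. ereal (v (R \<sigma>) / s \<sigma> powr a))"
  "0 \<le> Limsup at_top (\<lambda>\<sigma>. ereal (v (R \<sigma>) / s \<sigma> powr a))"
  "0 \<le> Liminf at_top (\<lambda>x. ereal (v x / w x powr a))"
  "0 \<le> Limsup at_top (\<lambda>x. ereal (v x / w x powr a))"
  "0 \<le> Liminf at_top (\<lambda>\<sigma>. ereal (w (R \<sigma>) / s \<sigma> powr a))"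
proof -
  have 1: "\<forall>\<^sub>F \<sigma> in at_top. 0 \<le> v (R \<sigma>) / s \<sigma> powr a"
    using eventually_R[OF eventually_v_nonneg] by eventually_elim simp
  have 2: "\<forall>\<^sub>F x in at_top. 0 \<le> v x / w x powr a"
    using eventually_v_nonneg by eventually_elim simp
  have 3: "\<forall>\<^sub>F \<sigma> in at_top. 0 \<le> w (R \<sigma>) / s \<sigma> powr a"
    using eventually_gt_one by eventually_elim simp
  show "0 \<le> Liminf at_top (\<lambda>\<sigma>. ereal (v (R \<sigma>) / s \<sigma> powr a))"
    "0 \<le> Limsup at_top (\<lambda>\<sigma>. ereal (v (R \<sigma>) / s \<sigma> powr a))"
    "0 \<le> Liminf at_top (\<lambda>x. ereal (v x / w x powr a))"
    "0 \<le> Limsup at_top (\<lambda>x. ereal (v x / w x powr a))"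
    "0 \<le> Liminf at_top (\<lambda>\<sigma>. ereal (w (R \<sigma>) / s \<sigma> powr a))"
    by (rule Liminf_nonneg Limsup_nonneg, rule 1 2 3)+
qed

text \<open>Both one-sided bounds, from the lower limit A and the upper limit B, hold eventually, so
  the pointwise estimate does too.\<close>

lemma weak_type_lower_bound:
  fixes lf lg l :: real
  defines "A \<equiv> Liminf at_top (\<lambda>\<sigma>. ereal (v (R \<sigma>) / s \<sigma> powr lf))"
    and "B \<equiv> Limsup at_top (\<lambda>x. ereal (v x / w x powr lg))"
  assumes "0 < lg" "lg * l \<le> lf" and qm: "quotient_meaningful A B"
  shows "ereal_powr (A / B) (1 / lg) \<le> Liminf at_top (\<lambda>\<sigma>. ereal (w (R \<sigma>) / s \<sigma> powr l))"
proof -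
  have A0: "0 \<le> A" and B0: "0 \<le> B" unfolding A_def B_def by (rule types_nonneg)+
  show ?thesis
  proof (rule ereal_powr_le)
    show "0 \<le> A / B" using A0 B0 by (rule zero_le_divide_ereal)
    fix c :: real assume c: "0 < c" "ereal c < A / B"
    then obtain \<beta> where \<beta>: "0 < \<beta>" "B < ereal \<beta>" "ereal (c * \<beta>) < A"
      using less_quotient_separate[OF A0 B0 qm] by blast
    have 1: "\<forall>\<^sub>F \<sigma> in at_top. c * \<beta> < v (R \<sigma>) / s \<sigma> powr lf"
      using less_LiminfD[OF \<beta>(3)[unfolded A_def]] by simp
    have 2: "\<forall>\<^sub>F \<sigma> in at_top. v (R \<sigma>) / w (R \<sigma>) powr lg < \<beta>"
      using eventually_R[OF Limsup_lessD[OF \<beta>(2)[unfolded B_def]]] by simp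
    have "\<forall>\<^sub>F \<sigma> in at_top. ereal (c powr (1 / lg)) \<le> ereal (w (R \<sigma>) / s \<sigma> powr l)"
      using 1 2 eventually_gt_one
    proof eventually_elim
      case (elim \<sigma>)
      then have "c powr (1 / lg) \<le> w (R \<sigma>) / s \<sigma> powr l"
        by (intro quotient_ge_pointwise[where \<beta> = \<beta> and lf = lf and V = "v (R \<sigma>)"])
          (use c \<beta> assms in auto)
      then show ?case by simp
    qed
    then show "ereal (c powr (1 / lg)) \<le> Liminf at_top (\<lambda>\<sigma>. ereal (w (R \<sigma>) / s \<sigma> powr l))"
      by (rule Liminf_bounded)
  qed (use assms types_nonneg in auto)
qed

text \<open>Here the bound on the numerator holds frequently and the one on the denominator
  eventually.\<close>

lemma weak_type_upper_bound_lower_type: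
  fixes lf rg l :: real
  defines "A \<equiv> Liminf at_top (\<lambda>\<sigma>. ereal (v (R \<sigma>) / s \<sigma> powr lf))"
    and "B \<equiv> Liminf at_top (\<lambda>x. ereal (v x / w x powr rg))"
  assumes "0 < rg" "lf \<le> rg * l" and qm: "quotient_meaningful A B"
  shows "Liminf at_top (\<lambda>\<sigma>. ereal (w (R \<sigma>) / s \<sigma> powr l)) \<le> ereal_powr (A / B) (1 / rg)"
proof -
  have A0: "0 \<le> A" and B0: "0 \<le> B" unfolding A_def B_def by (rule types_nonneg)+
  show ?thesis
  proof (rule le_ereal_powr)
    show "0 \<le> A / B" using A0 B0 by (rule zero_le_divide_ereal)
    fix c :: real assume c: "0 < c" "A / B < ereal c"
    then obtain \<beta> where \<beta>: "0 < \<beta>" "ereal \<beta> < B" "A < ereal (c * \<beta>)"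
      using quotient_less_separate[OF A0 B0 qm] by blast
    have 1: "\<exists>\<^sub>F \<sigma> in at_top. v (R \<sigma>) / s \<sigma> powr lf < c * \<beta>"
      using frequently_less_of_Liminf_less[OF \<beta>(3)[unfolded A_def]] by simp
    have 2: "\<forall>\<^sub>F \<sigma> in at_top. \<beta> < v (R \<sigma>) / w (R \<sigma>) powr rg"
      using eventually_R[OF less_LiminfD[OF \<beta>(2)[unfolded B_def]]] by simp
    have "\<exists>\<^sub>F \<sigma> in at_top. ereal (w (R \<sigma>) / s \<sigma> powr l) \<le> ereal (c powr (1 / rg))"
      using frequently_eventually_frequently[OF 1 eventually_conj[OF 2 eventually_gt_one]]
    proof (rule frequently_elim1, elim conjE)
      fix \<sigma> assume "v (R \<sigma>) / s \<sigma> powr lf < c * \<beta>" "\<beta> < v (R \<sigma>) / w (R \<sigma>) powr rg"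
        "1 < s \<sigma>" "1 < w (R \<sigma>)" "1 < v (R \<sigma>)"
      then show "ereal (w (R \<sigma>) / s \<sigma> powr l) \<le> ereal (c powr (1 / rg))"
        using quotient_le_pointwise[OF c(1) \<beta>(1) assms(3,4)] by simp
    qed
    then show "Liminf at_top (\<lambda>\<sigma>. ereal (w (R \<sigma>) / s \<sigma> powr l)) \<le> ereal (c powr (1 / rg))"
      by (rule Liminf_le_of_frequently)
  qed (use assms in auto)
qed

text \<open>The roles are exchanged: the numerator is bounded eventually, and the denominator
  frequently in x, which \<open>frequently_R\<close> turns into frequently in \<sigma>.\<close>

lemma weak_type_upper_bound_type:
  fixes lf rg l :: real
  defines "A \<equiv> Limsup at_top (\<lambda>\<sigma>. ereal (v (R \<sigma>) / s \<sigma> powr lf))"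
    and "B \<equiv> Limsup at_top (\<lambda>x. ereal (v x / w x powr rg))"
  assumes "0 < rg" "lf \<le> rg * l" and qm: "quotient_meaningful A B"
  shows "Liminf at_top (\<lambda>\<sigma>. ereal (w (R \<sigma>) / s \<sigma> powr l)) \<le> ereal_powr (A / B) (1 / rg)"
proof -
  have A0: "0 \<le> A" and B0: "0 \<le> B" unfolding A_def B_def by (rule types_nonneg)+
  show ?thesis
  proof (rule le_ereal_powr)
    show "0 \<le> A / B" using A0 B0 by (rule zero_le_divide_ereal)
    fix c :: real assume c: "0 < c" "A / B < ereal c"
    then obtain \<beta> where \<beta>: "0 < \<beta>" "ereal \<beta> < B" "A < ereal (c * \<beta>)"
      using quotient_less_separate[OF A0 B0 qm] by blast
    have 1: "\<forall>\<^sub>F \<sigma> in at_top. v (R \<sigma>) / s \<sigma> powr lf < c * \<beta>"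
      using Limsup_lessD[OF \<beta>(3)[unfolded A_def]] by simp
    have 2: "\<exists>\<^sub>F \<sigma> in at_top. \<beta> < v (R \<sigma>) / w (R \<sigma>) powr rg"
      using frequently_R[OF frequently_less_of_less_Limsup[OF \<beta>(2)[unfolded B_def]]] by simp
    have "\<exists>\<^sub>F \<sigma> in at_top. ereal (w (R \<sigma>) / s \<sigma> powr l) \<le> ereal (c powr (1 / rg))"
      using frequently_eventually_frequently[OF 2 eventually_conj[OF 1 eventually_gt_one]]
    proof (rule frequently_elim1, elim conjE)
      fix \<sigma> assume "v (R \<sigma>) / s \<sigma> powr lf < c * \<beta>" "\<beta> < v (R \<sigma>) / w (R \<sigma>) powr rg"
        "1 < s \<sigma>" "1 < w (R \<sigma>)" "1 < v (R \<sigma>)"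
      then show "ereal (w (R \<sigma>) / s \<sigma> powr l) \<le> ereal (c powr (1 / rg))"
        using quotient_le_pointwise[OF c(1) \<beta>(1) assms(3,4)] by simp
    qed
    then show "Liminf at_top (\<lambda>\<sigma>. ereal (w (R \<sigma>) / s \<sigma> powr l)) \<le> ereal (c powr (1 / rg))"
      by (rule Liminf_le_of_frequently)
  qed (use assms in auto)
qed

end

subsection \<open>The maximum modulus of a Dirichlet series\<close>

text \<open>The lower bound on second differences says that \<open>N\<close> is convex up to \<open>O(h\<^sup>4)\<close>;
  subtracting a chord and adding a small strictly convex term would otherwise produce an interior
  maximum.\<close>

lemma mono_of_second_difference:
  fixes N :: "real \<Rightarrow> real"
  assumes cont: "continuous_on UNIV N"
    and bdd: "\<And>b. \<exists>B. \<forall>x\<le>b. N x \<le> B"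
    and diff: "\<And>b. \<exists>C. \<forall>x\<le>b. \<forall>h. 0 < h \<and> h \<le> 1 \<longrightarrow> 2 * N x - C * h ^ 4 \<le> N (x + h) + N (x - h)"
  shows "mono N"
proof (rule monoI, rule ccontr)
  fix x1 x2 :: real
  assume "x1 \<le> x2" and "\<not> N x1 \<le> N x2"
  then have gt: "N x2 < N x1" and lt: "x1 < x2" by (simp, metis order_le_less order_refl)
  obtain B where B: "\<And>x. x \<le> x2 \<Longrightarrow> N x \<le> B" using bdd by blast
  obtain C where C: "\<forall>x\<le>x2. \<forall>h. 0 < h \<and> h \<le> 1 \<longrightarrow> 2 * N x - C * h ^ 4 \<le> N (x + h) + N (x - h)"
    using diff[of x2] ..
  \<comment> \<open>The linear term takes half of the drop N x1 - N x2 at \<open>x1\<close> and the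
    quadratic term with \<open>d\<close> takes a quarter, so \<phi> remains positive there.\<close>
  define e where "e = (N x1 - N x2) / (2 * (x2 - x1))"
  have e0: "0 < e" using lt gt by (simp add: e_def)
  have e1: "e * (x2 - x1) = (N x1 - N x2) / 2"
    using lt nonzero_mult_divide_mult_cancel_right[of "x2 - x1" "N x1 - N x2" 2]
    by (simp only: e_def times_divide_eq_left)
  \<comment> \<open>So far to the left that the linear term outweighs the bound \<open>B\<close>,
    which gives \<phi> a \<le> 0.\<close>
  define a where "a = min (x1 - 1) (x2 - (\<bar>B\<bar> + \<bar>N x2\<bar>) / e)"
  have a1: "a < x1" by (simp add: a_def)
  have "a \<le> x2 - (\<bar>B\<bar> + \<bar>N x2\<bar>) / e" by (simp add: a_def)
  then have a2: "\<bar>B\<bar> + \<bar>N x2\<bar> \<le> e * (x2 - a)" using e0 by (simp add: field_simps)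
  define d where "d = (N x1 - N x2) / (4 * ((x1 - a) * (x2 - x1)))"
  have d0: "0 < d" using lt gt a1 by (simp add: d_def)
  have d1: "d * ((x1 - a) * (x2 - x1)) = (N x1 - N x2) / 4" using lt a1 by (simp add: d_def)
  define \<phi> where "\<phi> x = N x - N x2 - e * (x2 - x) + d * ((x - a) * (x - x2))" for x
  have "\<phi> a = N a - N x2 - e * (x2 - a)" by (simp add: \<phi>_def)
  also have "\<dots> \<le> 0" using B[of a] a1 lt a2 by linarith
  finally have \<phi>a: "\<phi> a \<le> 0" .
  have \<phi>2: "\<phi> x2 = 0" by (simp add: \<phi>_def)
  have "\<phi> x1 = N x1 - N x2 - e * (x2 - x1) - d * ((x1 - a) * (x2 - x1))"
    by (simp add: \<phi>_def algebra_simps)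
  then have \<phi>1: "0 < \<phi> x1" using e1 d1 gt by simp
  have "continuous_on {a..x2} \<phi>"
    unfolding \<phi>_def by (intro continuous_intros continuous_on_subset[OF cont]) auto
  then obtain y where y: "y \<in> {a..x2}" "\<And>x. x \<in> {a..x2} \<Longrightarrow> \<phi> x \<le> \<phi> y"
    using continuous_attains_sup[of "{a..x2}" \<phi>] a1 lt by auto
  have "0 < \<phi> y" using y(2)[of x1] \<phi>1 a1 lt by simp
  then have ay: "a < y" "y < x2" using y(1) \<phi>a \<phi>2 by (auto simp: le_less)
  \<comment> \<open>Small enough that the error C * h ^ 4 is at most half of the second difference 2
    * d * h ^ 2 of the quadratic term, and that y + h and y - h stay in the interval.\<close>
  define h where "h = min (min 1 (d / (\<bar>C\<bar> + 1))) (min (y - a) (x2 - y))"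
  have h: "0 < h" "h \<le> 1" "h \<le> d / (\<bar>C\<bar> + 1)" "h \<le> y - a" "h \<le> x2 - y"
    using ay d0 by (auto simp: h_def)
  have "h * (\<bar>C\<bar> + 1) \<le> d" using h(3) by (simp add: pos_le_divide_eq add_nonneg_pos)
  moreover have "h * \<bar>C\<bar> \<le> h * (\<bar>C\<bar> + 1)" using h(1) by simp
  ultimately have hC: "\<bar>C\<bar> * h \<le> d" by (simp add: mult.commute)
  have "C * h ^ 4 \<le> \<bar>C\<bar> * h ^ 4" using h(1) by (intro mult_right_mono) auto
  also have "\<dots> = \<bar>C\<bar> * h * h ^ 3" by (simp add: power_numeral_reduce)
  also have "\<dots> \<le> d * h ^ 3" using hC h(1) by (intro mult_right_mono) auto
  also have "\<dots> \<le> d * h ^ 2" using d0 h by (intro mult_left_mono power_decreasing) auto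
  finally have small: "C * h ^ 4 \<le> d * h ^ 2" .
  have eq: "\<phi> (y + h) + \<phi> (y - h) - 2 * \<phi> y = N (y + h) + N (y - h) - 2 * N y + 2 * (d * h ^ 2)"
    by (simp add: \<phi>_def algebra_simps power2_eq_square)
  have le: "\<phi> (y + h) \<le> \<phi> y" "\<phi> (y - h) \<le> \<phi> y"
    using h by (auto intro!: y(2))
  have lower: "2 * N y - C * h ^ 4 \<le> N (y + h) + N (y - h)" using C h(1,2) ay by simp
  have "0 < d * h ^ 2" using d0 h by simp
  with small eq le lower show False by linarith
qed

text \<open>The k-th powers of the four fourth roots of unity sum to 0 for k = 1, 2, 3, so the cubic
  Taylor polynomials add up to 4 and only the remainders are left.\<close>

lemma norm_four_exp_le:
  fixes x :: real
  assumes "0 \<le> x"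
  shows "cmod (exp (of_real x) + exp (- of_real x) + exp (\<i> * of_real x) + exp (- (\<i> * of_real x)) - 4)
    \<le> x ^ 4 * exp x"
proof -
  define T :: "complex \<Rightarrow> complex" where "T z = (\<Sum>i\<le>3. z ^ i / fact i)" for z
  have T: "T z = 1 + z + z ^ 2 / 2 + z ^ 3 / 6" for z
    by (simp add: T_def numeral_eq_Suc)
  \<comment> \<open>The Taylor constant 1/6 is weakened to 1/4 so that four remainders sum to the
    claimed bound.\<close>
  have bound: "cmod (exp z - T z) \<le> x ^ 4 * exp x / 4" if "cmod z = x" for z
  proof -
    have "cmod (exp z - T z) \<le> exp x * x ^ 4 / 6"
      using Taylor_exp_field[of z 3] that by (simp add: T_def fact_numeral)
    also have "\<dots> \<le> x ^ 4 * exp x / 4" using assms by (simp add: field_simps)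
    finally show ?thesis .
  qed
  let ?x = "complex_of_real x"
  have eq: "exp ?x + exp (- ?x) + exp (\<i> * ?x) + exp (- (\<i> * ?x)) - 4
    = ((exp ?x - T ?x) + (exp (- ?x) - T (- ?x))) +
      ((exp (\<i> * ?x) - T (\<i> * ?x)) + (exp (- (\<i> * ?x)) - T (- (\<i> * ?x))))"
    by (simp add: T power_mult_distrib power2_eq_square power3_eq_cube field_simps)
  have "cmod ((exp ?x - T ?x) + (exp (- ?x) - T (- ?x))) \<le> x ^ 4 * exp x / 4 + x ^ 4 * exp x / 4"
    using assms by (intro norm_triangle_mono bound) auto
  moreover have "cmod ((exp (\<i> * ?x) - T (\<i> * ?x)) + (exp (- (\<i> * ?x)) - T (- (\<i> * ?x))))
      \<le> x ^ 4 * exp x / 4 + x ^ 4 * exp x / 4"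
    using assms by (intro norm_triangle_mono bound) (auto simp: norm_mult)
  ultimately show ?thesis
    unfolding eq by (intro order_trans[OF norm_triangle_ineq]) linarith
qed

section \<open>Dirichlet series with nonnegative exponents\<close>

lemma bounded_linear_scaleC: "bounded_linear (\<lambda>x :: 'a::complex_banach. c *\<^sub>C x)"
proof (rule bounded_linear_intro[where K = "cmod c"])
  show "c *\<^sub>C (x + y) = c *\<^sub>C x + c *\<^sub>C y" for x y :: 'a by (rule scaleC_add_right)
  show "c *\<^sub>C (r *\<^sub>R x) = r *\<^sub>R (c *\<^sub>C x)" for r and x :: 'a
    by (simp add: scaleC_of_real[symmetric] scaleC_scaleC mult.commute)
  show "norm (c *\<^sub>C x) \<le> norm x * cmod c" for x :: 'a by (simp add: norm_scaleC)
qed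

lemma scaleC_diff_left: "(c - d) *\<^sub>C x = c *\<^sub>C x - d *\<^sub>C (x :: 'a::complex_banach)"
  using scaleC_add_left[of "c - d" d x] by simp

text \<open>Exponents may be 0 because the locale is applied to the differences
  \<open>l n - l 0\<close>.\<close>

locale dirichlet_series =
  fixes a :: "nat \<Rightarrow> 'a::complex_banach" and \<mu> :: "nat \<Rightarrow> real"
  assumes exponent_nonneg: "\<And>n. 0 \<le> \<mu> n"
    and summable_majorant: "\<And>\<sigma>. summable (\<lambda>n. norm (a n) * exp (\<sigma> * \<mu> n))"
begin

definition F :: "complex \<Rightarrow> 'a" where
  "F s = (\<Sum>n. exp (s * complex_of_real (\<mu> n)) *\<^sub>C a n)"

text \<open>Powers of \<open>\<mu> n\<close> in termwise estimates are absorbed by exponentials,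
  that is, by raising the argument of the majorant by 1 or 2.\<close>

definition majorant :: "real \<Rightarrow> real" where
  "majorant \<sigma> = (\<Sum>n. norm (a n) * exp (\<sigma> * \<mu> n))"

abbreviation M :: "real \<Rightarrow> real" where "M \<equiv> max_modulus F"

lemma norm_series_le:
  fixes f :: "nat \<Rightarrow> 'a"
  assumes "f sums x" and "\<And>n. norm (f n) \<le> k * (norm (a n) * exp (\<sigma> * \<mu> n))"
  shows "norm x \<le> k * majorant \<sigma>"
proof -
  have s: "summable (\<lambda>n. k * (norm (a n) * exp (\<sigma> * \<mu> n)))"
    by (intro summable_mult summable_majorant)
  have sn: "summable (\<lambda>n. norm (f n))"
    by (rule summable_comparison_test'[OF s, of 0]) (use assms in simp)
  have "norm x = norm (suminf f)" using assms(1) by (simp add: sums_iff)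
  also have "\<dots> \<le> (\<Sum>n. norm (f n))" by (rule summable_norm[OF sn])
  also have "\<dots> \<le> (\<Sum>n. k * (norm (a n) * exp (\<sigma> * \<mu> n)))"
    by (rule suminf_le[OF assms(2) sn s])
  also have "\<dots> = k * majorant \<sigma>"
    unfolding majorant_def by (rule suminf_mult[OF summable_majorant])
  finally show ?thesis .
qed

lemma F_sums: "(\<lambda>n. exp (s * complex_of_real (\<mu> n)) *\<^sub>C a n) sums F s"
proof -
  have "summable (\<lambda>n. exp (s * complex_of_real (\<mu> n)) *\<^sub>C a n)"
    by (rule summable_comparison_test'[OF summable_majorant[of "Re s"], of 0])
      (simp add: norm_scaleC)
  then show ?thesis unfolding F_def by (rule summable_sums)
qed

lemma majorant_mono: "\<sigma> \<le> \<sigma>' \<Longrightarrow> majorant \<sigma> \<le> majorant \<sigma>'"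
  unfolding majorant_def
  by (intro suminf_le summable_majorant mult_left_mono) (auto simp: exponent_nonneg mult_right_mono)

lemma norm_F_le_majorant: "norm (F s) \<le> majorant (Re s)"
  using norm_series_le[OF F_sums, of s 1 "Re s"] by (simp add: norm_scaleC)

lemma norm_F_le_M: "norm (F (Complex \<sigma> t)) \<le> M \<sigma>"
  unfolding max_modulus_def
proof (rule cSUP_upper)
  show "bdd_above (range (\<lambda>t. norm (F (Complex \<sigma> t))))"
    using norm_F_le_majorant[of "Complex \<sigma> _"] by (auto intro!: bdd_aboveI)
qed simp

lemma M_le: "(\<And>t. norm (F (Complex \<sigma> t)) \<le> B) \<Longrightarrow> M \<sigma> \<le> B"
  unfolding max_modulus_def by (rule cSUP_least) auto

text \<open>On a horizontal line both exponentials have the same phase, so only real exponentials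
  are compared. The bounds 1 - exp (- u) \<le> u and \<mu> \<le> exp \<mu> then cost a shift of the
  argument by 1.\<close>

lemma norm_F_diff_le:
  assumes "x \<le> y"
  shows "norm (F (Complex y t) - F (Complex x t)) \<le> (y - x) * majorant (y + 1)"
proof (rule norm_series_le[OF sums_diff[OF F_sums F_sums]])
  fix n
  have m: "0 \<le> \<mu> n" by (rule exponent_nonneg)
  let ?E = "\<lambda>z. exp (z * complex_of_real (\<mu> n))"
  have "?E (Complex y t) - ?E (Complex x t)
      = of_real (exp (y * \<mu> n) - exp (x * \<mu> n)) * exp (\<i> * of_real (t * \<mu> n))"
    by (simp add: Complex_eq algebra_simps exp_add flip: exp_of_real)
  then have "cmod (?E (Complex y t) - ?E (Complex x t)) = \<bar>exp (y * \<mu> n) - exp (x * \<mu> n)\<bar>"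
    by (simp add: norm_mult del: of_real_diff)
  also have "\<dots> = exp (y * \<mu> n) - exp (x * \<mu> n)"
    using assms m by (simp add: mult_right_mono)
  also have "\<dots> = exp (y * \<mu> n) * (1 - exp ((x - y) * \<mu> n))"
    by (simp add: algebra_simps flip: exp_add)
  also have "\<dots> \<le> exp (y * \<mu> n) * ((y - x) * \<mu> n)"
    using exp_ge_add_one_self[of "(x - y) * \<mu> n"] by (intro mult_left_mono) (auto simp: algebra_simps)
  also have "\<dots> \<le> exp (y * \<mu> n) * ((y - x) * exp (\<mu> n))"
    using assms by (intro mult_left_mono less_imp_le[OF exp_gt_self]) auto
  also have "\<dots> = (y - x) * exp ((y + 1) * \<mu> n)"
    by (simp add: algebra_simps exp_add)
  finally have "cmod (?E (Complex y t) - ?E (Complex x t)) * norm (a n)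
      \<le> ((y - x) * exp ((y + 1) * \<mu> n)) * norm (a n)"
    by (rule mult_right_mono) simp
  then show "norm (?E (Complex y t) *\<^sub>C a n - ?E (Complex x t) *\<^sub>C a n)
      \<le> (y - x) * (norm (a n) * exp ((y + 1) * \<mu> n))"
    by (simp add: norm_scaleC mult_ac flip: scaleC_diff_left)
qed

lemma M_diff_le:
  assumes "x \<le> y"
  shows "\<bar>M y - M x\<bar> \<le> (y - x) * majorant (y + 1)"
proof -
  have "norm (F (Complex y t)) \<le> M x + (y - x) * majorant (y + 1)" for t
    using norm_F_diff_le[OF assms, of t] norm_F_le_M[of x t]
      norm_triangle_ineq2[of "F (Complex y t)" "F (Complex x t)"] by linarith
  then have 1: "M y \<le> M x + (y - x) * majorant (y + 1)" by (rule M_le)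
  have "norm (F (Complex x t)) \<le> M y + (y - x) * majorant (y + 1)" for t
    using norm_F_diff_le[OF assms, of t] norm_F_le_M[of y t]
      norm_triangle_ineq3[of "F (Complex y t)" "F (Complex x t)"] by linarith
  then have 2: "M x \<le> M y + (y - x) * majorant (y + 1)" by (rule M_le)
  from 1 2 show ?thesis by linarith
qed

lemma continuous_M: "continuous_on UNIV M"
  unfolding continuous_on_eq_continuous_at[OF open_UNIV]
proof
  fix x
  have "((\<lambda>y. M y - M x) \<longlongrightarrow> 0) (at x)"
  proof (rule Lim_null_comparison)
    \<comment> \<open>Within distance 1 of x the Lipschitz constant from \<open>M_diff_le\<close> is
      bounded by the fixed number \<open>majorant (x + 2)\<close>.\<close>
    have "\<forall>\<^sub>F y in at x. y \<in> {x - 1<..<x + 1}"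
      by (intro eventually_at_in_open') auto
    then show "\<forall>\<^sub>F y in at x. norm (M y - M x) \<le> \<bar>y - x\<bar> * majorant (x + 2)"
    proof eventually_elim
      case (elim y)
      have "norm (M y - M x) \<le> \<bar>y - x\<bar> * majorant (max x y + 1)"
        using M_diff_le[of x y] M_diff_le[of y x] by (cases "x \<le> y") (auto simp: abs_minus_commute)
      also have "\<dots> \<le> \<bar>y - x\<bar> * majorant (x + 2)"
        using elim by (intro mult_left_mono majorant_mono) auto
      finally show ?case .
    qed
    show "((\<lambda>y. \<bar>y - x\<bar> * majorant (x + 2)) \<longlongrightarrow> 0) (at x)"
      by (auto intro!: tendsto_eq_intros)
  qed
  then show "isCont M x" unfolding isCont_def by (rule LIM_zero_cancel)
qed

text \<open>Averaging over the four points \<open>s \<plusminus> h\<close>, \<open>s \<plusminus> \<i>h\<close> reproduces \<open>F s\<close> up to \<open>O(h\<^sup>4)\<close>, because the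
  Taylor terms of degrees 1, 2 and 3 cancel.\<close>

lemma norm_four_point_le:
  assumes h: "0 < h" "h \<le> 1"
  shows "norm (F (Complex (x + h) t) + F (Complex (x - h) t) + F (Complex x (t + h))
      + F (Complex x (t - h)) - 4 *\<^sub>R F (Complex x t)) \<le> (256 * h ^ 4) * majorant (x + 2)"
proof (rule norm_series_le[OF sums_diff[OF sums_add[OF sums_add[OF sums_add[OF F_sums F_sums] F_sums]
      F_sums] bounded_linear.sums[OF bounded_linear_scaleR_right F_sums]]])
  fix n
  have m: "0 \<le> \<mu> n" by (rule exponent_nonneg)
  let ?E = "\<lambda>z. exp (z * complex_of_real (\<mu> n))"
  define y where "y = h * \<mu> n"
  have y0: "0 \<le> y" using h m by (simp add: y_def)
  have "?E (Complex (x + h) t) + ?E (Complex (x - h) t) + ?E (Complex x (t + h))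
      + ?E (Complex x (t - h)) - 4 * ?E (Complex x t)
    = ?E (Complex x t) * (exp (of_real y) + exp (- of_real y)
        + exp (\<i> * of_real y) + exp (- (\<i> * of_real y)) - 4)"
    by (simp add: Complex_eq y_def algebra_simps flip: exp_add)
  then have "cmod (?E (Complex (x + h) t) + ?E (Complex (x - h) t) + ?E (Complex x (t + h))
      + ?E (Complex x (t - h)) - 4 * ?E (Complex x t))
    = exp (x * \<mu> n) * cmod (exp (of_real y) + exp (- of_real y)
        + exp (\<i> * of_real y) + exp (- (\<i> * of_real y)) - 4)"
    by (simp add: norm_mult)
  also have "\<dots> \<le> exp (x * \<mu> n) * (y ^ 4 * exp y)"
    by (intro mult_left_mono norm_four_exp_le y0) simp
  also have "\<dots> \<le> exp (x * \<mu> n) * ((256 * h ^ 4 * exp (\<mu> n)) * exp (\<mu> n))"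
  proof (intro mult_left_mono mult_mono)
    \<comment> \<open>The fourth power of this inequality produces the constant 256 = 4 ^ 4. One
      factor \<open>exp (\<mu> n)\<close> absorbs the power of \<open>\<mu> n\<close> and another
      one \<open>exp y\<close>, hence the argument x + 2.\<close>
    have "\<mu> n / 4 \<le> exp (\<mu> n / 4)"
      using exp_ge_add_one_self[of "\<mu> n / 4"] by linarith
    then have "(\<mu> n / 4) ^ 4 \<le> exp (\<mu> n / 4) ^ 4" using m by (intro power_mono) auto
    then have "\<mu> n ^ 4 \<le> 256 * exp (\<mu> n)"
      by (simp add: power_divide flip: exp_of_nat_mult)
    then have "h ^ 4 * \<mu> n ^ 4 \<le> h ^ 4 * (256 * exp (\<mu> n))"
      using h by (intro mult_left_mono) auto
    then show "y ^ 4 \<le> 256 * h ^ 4 * exp (\<mu> n)" by (simp add: y_def power_mult_distrib mult_ac)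
    show "exp y \<le> exp (\<mu> n)" using h m by (simp add: y_def mult_left_le_one_le)
  qed (use h in auto)
  also have "\<dots> = 256 * h ^ 4 * exp ((x + 2) * \<mu> n)"
    by (simp add: algebra_simps flip: exp_add)
  finally have le: "cmod (?E (Complex (x + h) t) + ?E (Complex (x - h) t) + ?E (Complex x (t + h))
      + ?E (Complex x (t - h)) - 4 * ?E (Complex x t)) * norm (a n)
      \<le> (256 * h ^ 4 * exp ((x + 2) * \<mu> n)) * norm (a n)"
    by (rule mult_right_mono) simp
  have "4 *\<^sub>R (?E (Complex x t) *\<^sub>C a n) = (4 * ?E (Complex x t)) *\<^sub>C a n"
    by (simp add: scaleC_of_real[symmetric] scaleC_scaleC)
  then show "norm (?E (Complex (x + h) t) *\<^sub>C a n + ?E (Complex (x - h) t) *\<^sub>C a n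
      + ?E (Complex x (t + h)) *\<^sub>C a n + ?E (Complex x (t - h)) *\<^sub>C a n
      - 4 *\<^sub>R (?E (Complex x t) *\<^sub>C a n))
    \<le> 256 * h ^ 4 * (norm (a n) * exp ((x + 2) * \<mu> n))"
    using le by (simp add: norm_scaleC mult_ac flip: scaleC_diff_left scaleC_add_left)
qed

text \<open>The two vertical neighbours have real part x and contribute at most \<open>M x\<close>
  each. Removing them from 4 * M x leaves a second difference in the real direction alone.\<close>

lemma M_second_difference:
  assumes "0 < h" "h \<le> 1"
  shows "2 * M x - 256 * h ^ 4 * majorant (x + 2) \<le> M (x + h) + M (x - h)"
proof -
  have "norm (F (Complex x t)) \<le> (M (x + h) + M (x - h) + 2 * M x + 256 * h ^ 4 * majorant (x + 2)) / 4" for t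
  proof -
    define S where "S = F (Complex (x + h) t) + F (Complex (x - h) t) + F (Complex x (t + h))
      + F (Complex x (t - h))"
    have "norm S \<le> M (x + h) + M (x - h) + M x + M x"
      unfolding S_def by (intro norm_triangle_mono norm_F_le_M)
    moreover have "norm (S - 4 *\<^sub>R F (Complex x t)) \<le> 256 * h ^ 4 * majorant (x + 2)"
      unfolding S_def by (rule norm_four_point_le[OF assms])
    moreover have "norm (4 *\<^sub>R F (Complex x t)) - norm S \<le> norm (S - 4 *\<^sub>R F (Complex x t))"
      by (metis norm_minus_commute norm_triangle_ineq2)
    ultimately show ?thesis by simp
  qed
  from M_le[OF this] show ?thesis by simp
qed

lemma mono_M: "mono M"
proof (rule mono_of_second_difference[OF continuous_M])
  fix b
  have "M x \<le> majorant b" if "x \<le> b" for x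
    using norm_F_le_majorant[of "Complex x _"] majorant_mono[OF that] by (intro M_le) (auto intro: order_trans)
  then show "\<exists>B. \<forall>x\<le>b. M x \<le> B" by blast
  have "2 * M x - 256 * majorant (b + 2) * h ^ 4 \<le> M (x + h) + M (x - h)"
    if "x \<le> b" "0 < h" "h \<le> 1" for x h
  proof -
    have "256 * h ^ 4 * majorant (x + 2) \<le> 256 * h ^ 4 * majorant (b + 2)"
      using that by (intro mult_left_mono majorant_mono) auto
    then show ?thesis using M_second_difference[OF that(2,3), of x] by (simp add: mult_ac)
  qed
  then show "\<exists>C. \<forall>x\<le>b. \<forall>h. 0 < h \<and> h \<le> 1 \<longrightarrow> 2 * M x - C * h ^ 4 \<le> M (x + h) + M (x - h)"
    by blast
qed

end

text \<open>The decay of the coefficients beats every exponential, so the terms can be compared with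
  1 / (n + 1)^2.\<close>

lemma vvds_coefficients_summable:
  fixes a :: "nat \<Rightarrow> 'a::real_normed_vector" and l :: "nat \<Rightarrow> real"
  assumes pos: "\<And>n. 0 < l n"
    and density: "limsup (\<lambda>n. ereal (ln (real (Suc n)) / l n)) < \<infinity>"
    and decay: "limsup (\<lambda>n. if a n = 0 then - \<infinity> else ereal (ln (norm (a n)) / l n)) = - \<infinity>"
  shows "summable (\<lambda>n. norm (a n) * exp (\<sigma> * l n))"
proof -
  obtain D where "limsup (\<lambda>n. ereal (ln (real (Suc n)) / l n)) < ereal D"
    using ereal_dense2[OF density] by blast
  then have 1: "\<forall>\<^sub>F n in sequentially. ln (real (Suc n)) / l n < D"
    by (auto dest: Limsup_lessD)
  \<comment> \<open>The threshold cancels the factor exp (\<sigma> * l n) and leaves exp (- 2 * D *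
    l n), which is at most (n + 1)^(-2) by the choice of \<open>D\<close>.\<close>
  have 2: "\<forall>\<^sub>F n in sequentially.
      (if a n = 0 then - \<infinity> else ereal (ln (norm (a n)) / l n)) < ereal (- \<sigma> - 2 * D)"
    by (rule Limsup_lessD) (simp add: decay)
  have "\<forall>\<^sub>F n in sequentially. norm (norm (a n) * exp (\<sigma> * l n)) \<le> inverse (real (Suc n) ^ 2)"
    using 1 2
  proof eventually_elim
    case (elim n)
    show ?case
    proof (cases "a n = 0")
      case False
      have d: "ln (real (Suc n)) \<le> D * l n"
        using elim(1) pos[of n] by (simp add: pos_divide_less_eq)
      have "ln (norm (a n)) < (- \<sigma> - 2 * D) * l n"
        using elim(2) False pos[of n] by (simp add: pos_divide_less_eq)
      then have "ln (norm (a n)) + \<sigma> * l n \<le> - (2 * (D * l n))" by (simp add: algebra_simps)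
      also have "\<dots> \<le> - (2 * ln (real (Suc n)))" using d by simp
      finally have "exp (ln (norm (a n)) + \<sigma> * l n) \<le> exp (- (2 * ln (real (Suc n))))"
        by (simp only: exp_le_cancel_iff)
      moreover have "exp (2 * ln (real (Suc n))) = real (Suc n) ^ 2"
        by (simp only: exp_double exp_ln of_nat_0_less_iff zero_less_Suc)
      ultimately show ?thesis using False by (simp only: exp_add exp_minus) simp
    qed simp
  qed
  then show ?thesis
  proof (rule summable_comparison_test_ev)
    show "summable (\<lambda>n. inverse (real (Suc n) ^ 2))"
      using inverse_power_summable[of 2, where ?'a = real] by (subst summable_Suc_iff) simp
  qed
qed

text \<open>Splitting off the leading exponential \<open>e\<^bsup>c s\<^esup>\<close> leaves a series whose exponents are still
  nonnegative, so its maximum modulus is nondecreasing as well; strict monotonicity and unboundedness of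
  \<^term>\<open>max_modulus f\<close> come from the factor \<open>e\<^bsup>c \<sigma>\<^esup>\<close>.\<close>

lemma vvds_max_modulus:
  assumes "vvds f"
  obtains c N where "0 < c" "\<And>\<sigma>. max_modulus f \<sigma> = exp (c * \<sigma>) * N \<sigma>"
    "mono N" "continuous_on UNIV N" "\<And>\<sigma>. 0 \<le> N \<sigma>" "\<exists>\<sigma>. 0 < N \<sigma>"
proof -
  obtain a l s0 where s0: "f s0 \<noteq> 0"
    and l: "\<And>n. 0 < l n" "\<And>n. l n < l (Suc n)"
    and density: "limsup (\<lambda>n. ereal (ln (real (Suc n)) / l n)) < \<infinity>"
    and decay: "limsup (\<lambda>n. if a n = 0 then - \<infinity> else ereal (ln (norm (a n)) / l n)) = - \<infinity>"
    and f: "\<And>s. (\<lambda>n. exp (s * complex_of_real (l n)) *\<^sub>C a n) sums f s"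
    using assms unfolding vvds_def by blast
  interpret D: dirichlet_series a "\<lambda>n. l n - l 0"
  proof
    show "0 \<le> l n - l 0" for n using lift_Suc_mono_le[of l 0 n] l(2) by (simp add: less_imp_le)
    show "summable (\<lambda>n. norm (a n) * exp (\<sigma> * (l n - l 0)))" for \<sigma>
      using summable_mult[OF vvds_coefficients_summable[OF l(1) density decay, of \<sigma>], of "exp (- (\<sigma> * l 0))"]
      by (simp add: algebra_simps exp_diff exp_minus field_simps)
  qed
  have fD: "f s = exp (s * complex_of_real (l 0)) *\<^sub>C D.F s" for s
  proof (rule sums_unique2[OF f])
    show "(\<lambda>n. exp (s * complex_of_real (l n)) *\<^sub>C a n) sums (exp (s * complex_of_real (l 0)) *\<^sub>C D.F s)"
      using bounded_linear.sums[OF bounded_linear_scaleC D.F_sums, of "exp (s * complex_of_real (l 0))" s]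
      by (simp add: scaleC_scaleC algebra_simps flip: exp_add)
  qed
  have norm_f: "norm (f (Complex \<sigma> t)) = exp (l 0 * \<sigma>) * norm (D.F (Complex \<sigma> t))" for \<sigma> t
    by (simp add: fD norm_scaleC mult.commute)
  have le: "norm (f (Complex \<sigma> t)) \<le> exp (l 0 * \<sigma>) * D.M \<sigma>" for \<sigma> t
    unfolding norm_f by (intro mult_left_mono D.norm_F_le_M) simp
  have eq: "max_modulus f \<sigma> = exp (l 0 * \<sigma>) * D.M \<sigma>" for \<sigma>
  proof (rule antisym)
    show "max_modulus f \<sigma> \<le> exp (l 0 * \<sigma>) * D.M \<sigma>"
      unfolding max_modulus_def[of f] by (rule cSUP_least) (auto intro: le)
    have "norm (f (Complex \<sigma> t)) \<le> max_modulus f \<sigma>" for t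
      unfolding max_modulus_def[of f] by (rule cSUP_upper) (auto intro!: bdd_aboveI le)
    then have "D.M \<sigma> \<le> max_modulus f \<sigma> / exp (l 0 * \<sigma>)"
      by (intro D.M_le) (simp add: norm_f pos_le_divide_eq mult.commute)
    then show "exp (l 0 * \<sigma>) * D.M \<sigma> \<le> max_modulus f \<sigma>"
      by (simp add: pos_le_divide_eq mult.commute)
  qed
  have nonneg: "0 \<le> D.M \<sigma>" for \<sigma>
    using order_trans[OF norm_ge_zero D.norm_F_le_M] .
  have "D.F s0 \<noteq> 0"
  proof
    assume "D.F s0 = 0"
    then show False using s0 fD[of s0] norm_scaleC[of "exp (s0 * complex_of_real (l 0))" "D.F s0"] by simp
  qed
  then have "0 < D.M (Re s0)"
    using D.norm_F_le_M[of "Re s0" "Im s0"] by (simp add: less_le_trans[OF _ D.norm_F_le_M[of _ "Im s0"]])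
  then show ?thesis
    using that[OF l(1) eq D.mono_M D.continuous_M nonneg] by blast
qed

section \<open>Monotonicity, growth and inversion of the maximum modulus\<close>

lemma vvds_max_modulus_mono:
  assumes "vvds f"
  shows "mono (max_modulus f)"
proof -
  obtain c N where N: "0 < c" "\<And>\<sigma>. max_modulus f \<sigma> = exp (c * \<sigma>) * N \<sigma>" "mono N" "\<And>\<sigma>. 0 \<le> N \<sigma>"
    using vvds_max_modulus[OF assms] by metis
  show ?thesis unfolding N(2)
    by (intro monoI mult_mono) (use N(1) in \<open>auto intro: monoD[OF N(3)] N(4)\<close>)
qed

text \<open>The factor exp (c * \<sigma>) gives strict growth from every point where
  \<open>N\<close> is positive; the factorization alone leaves open whether \<open>N\<close>
  vanishes far to the left.\<close>

lemma vvds_max_modulus_inj: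
  assumes "vvds f" "max_modulus f x = max_modulus f y" "0 < max_modulus f x"
  shows "x = y"
proof -
  obtain c N where N: "0 < c" "\<And>\<sigma>. max_modulus f \<sigma> = exp (c * \<sigma>) * N \<sigma>" "mono N" "\<And>\<sigma>. 0 \<le> N \<sigma>"
    using vvds_max_modulus[OF assms(1)] by metis
  have strict: "max_modulus f u < max_modulus f v" if "0 < max_modulus f u" "u < v" for u v
  proof -
    have "0 < N u" using that(1) by (simp add: N(2) zero_less_mult_iff)
    then have "exp (c * u) * N u < exp (c * v) * N u" using that N(1) by simp
    also have "\<dots> \<le> exp (c * v) * N v" using that(2) by (intro mult_left_mono monoD[OF N(3)]) auto
    finally show ?thesis by (simp add: N(2))
  qed
  show ?thesis using strict[of x y] strict[of y x] assms by (cases x y rule: linorder_cases) auto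
qed

lemma vvds_max_modulus_continuous:
  assumes "vvds f"
  shows "continuous_on UNIV (max_modulus f)"
proof -
  obtain c N where N: "\<And>\<sigma>. max_modulus f \<sigma> = exp (c * \<sigma>) * N \<sigma>" "continuous_on UNIV N"
    using vvds_max_modulus[OF assms] by metis
  have "max_modulus f = (\<lambda>\<sigma>. exp (c * \<sigma>) * N \<sigma>)" using N(1) by (rule ext)
  then show ?thesis by (auto intro!: continuous_intros N(2))
qed

lemma vvds_max_modulus_at_top:
  assumes "vvds f"
  shows "filterlim (max_modulus f) at_top at_top"
proof -
  obtain c N x where N: "0 < c" "\<And>\<sigma>. max_modulus f \<sigma> = exp (c * \<sigma>) * N \<sigma>" "mono N" "0 < N x"
    using vvds_max_modulus[OF assms] by metis
  have "filterlim (\<lambda>\<sigma>. N x * exp (c * \<sigma>)) at_top at_top"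
    by (intro filterlim_tendsto_pos_mult_at_top[OF tendsto_const N(4)] filterlim_compose[OF exp_at_top]
        filterlim_tendsto_pos_mult_at_top[OF tendsto_const N(1)] filterlim_ident)
  moreover have "\<forall>\<^sub>F \<sigma> in at_top. N x * exp (c * \<sigma>) \<le> max_modulus f \<sigma>"
    using eventually_ge_at_top[of x]
    by eventually_elim (auto simp: N(2) mult.commute intro: monoD[OF N(3)])
  ultimately show ?thesis by (rule filterlim_at_top_mono)
qed

lemma vvds_max_modulus_attains:
  assumes "vvds f"
  shows "\<forall>\<^sub>F y in at_top. \<exists>x\<ge>S. max_modulus f x = y"
  using eventually_ge_at_top[of "max_modulus f S"]
proof eventually_elim
  case (elim y)
  have "\<forall>\<^sub>F x in at_top. y \<le> max_modulus f x \<and> S \<le> x"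
    using vvds_max_modulus_at_top[OF assms] eventually_ge_at_top[of S]
    by (auto simp: filterlim_at_top intro: eventually_conj)
  then obtain b where "y \<le> max_modulus f b" "S \<le> b"
    using eventually_happens[of _ "at_top :: real filter"] by auto
  then show ?case
    using IVT'[of "max_modulus f" S y b] elim continuous_on_subset[OF vvds_max_modulus_continuous[OF assms]]
    by auto
qed

text \<open>\<open>inv\<close> picks some preimage, hence is a right inverse at every attained
  value, and all large values are attained.\<close>

lemma vvds_inv_max_modulus:
  assumes "vvds f"
  shows "\<forall>\<^sub>F y in at_top. max_modulus f (inv (max_modulus f) y) = y"
  using vvds_max_modulus_attains[OF assms]
  by eventually_elim (auto intro: f_inv_into_f)

lemma vvds_inv_max_modulus_at_top:
  assumes "vvds f"
  shows "filterlim (inv (max_modulus f)) at_top at_top"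
  unfolding filterlim_at_top
proof
  fix Z
  show "\<forall>\<^sub>F y in at_top. Z \<le> inv (max_modulus f) y"
    using eventually_gt_at_top[of "max_modulus f Z"] vvds_inv_max_modulus[OF assms]
  proof eventually_elim
    case (elim y)
    then show ?case
      using monoD[OF vvds_max_modulus_mono[OF assms], of "inv (max_modulus f) y" Z] by (cases rule: le_cases) auto
  qed
qed

subsection \<open>Relative growth\<close>

lemma rel_modulus_at_top:
  assumes "vvds f" "vvds g"
  shows "filterlim (rel_modulus g f) at_top at_top"
  unfolding rel_modulus_def
  by (rule filterlim_compose[OF vvds_inv_max_modulus_at_top vvds_max_modulus_at_top]) (rule assms)+

text \<open>The maximum modulus of g cancels its right inverse at the large value
  \<open>max_modulus f \<sigma>\<close>.\<close>

lemma rel_modulus_compose: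
  assumes "vvds f" "vvds g"
  shows "\<forall>\<^sub>F \<sigma> in at_top. rel_modulus h g (rel_modulus g f \<sigma>) = rel_modulus h f \<sigma>"
  using eventually_compose_filterlim[OF vvds_inv_max_modulus[OF assms(2)] vvds_max_modulus_at_top[OF assms(1)]]
  by eventually_elim (simp add: rel_modulus_def)

text \<open>For large x the value \<open>max_modulus g x\<close> is taken by the maximum modulus of
  f beyond S. Being positive, it has x as its only preimage under that of g, so the chosen inverse
  returns x.\<close>

lemma rel_modulus_attains:
  assumes "vvds f" "vvds g"
  shows "\<forall>\<^sub>F x in at_top. \<exists>\<sigma>\<ge>S. rel_modulus g f \<sigma> = x"
  using eventually_compose_filterlim[OF vvds_max_modulus_attains[OF assms(1)] vvds_max_modulus_at_top[OF assms(2)], of S]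
    eventually_compose_filterlim[OF eventually_gt_at_top[of 0] vvds_max_modulus_at_top[OF assms(2)]]
proof eventually_elim
  case (elim x)
  then obtain \<sigma> where \<sigma>: "S \<le> \<sigma>" "max_modulus f \<sigma> = max_modulus g x" by blast
  have eq: "max_modulus g (inv (max_modulus g) (max_modulus g x)) = max_modulus g x"
    by (rule f_inv_into_f) simp
  have "inv (max_modulus g) (max_modulus g x) = x"
    by (rule vvds_max_modulus_inj[OF assms(2) eq]) (simp only: eq elim(2))
  then have "rel_modulus g f \<sigma> = x" by (simp only: rel_modulus_def \<sigma>(2))
  with \<sigma>(1) show ?case by blast
qed

text \<open>The case k = 0 is covered as well, since index -1 is the exponential; so orders are
  quotients of logarithms of the quantities in the types even for index 0.\<close>

lemma iter_log_eq_ln: "0 \<le> k \<Longrightarrow> iter_log k x = ln (iter_log (k - 1) x)"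
proof (cases "k = 0")
  case False
  assume "0 \<le> k"
  with False have "nat k = Suc (nat (k - 1))" by simp
  then show ?thesis using False \<open>0 \<le> k\<close> by (simp add: iter_log_def)
qed (simp add: iter_log_def)

lemma iter_log_at_top:
  assumes "- 1 \<le> k"
  shows "filterlim (iter_log k) at_top at_top"
  using assms
proof (induction k rule: int_ge_induct)
  case base
  have "iter_log (- 1) = exp" by (auto simp: iter_log_def fun_eq_iff)
  then show ?case by (simp add: exp_at_top)
next
  case (step k)
  then have "iter_log (k + 1) = (\<lambda>x. ln (iter_log k x))"
    using iter_log_eq_ln[of "k + 1"] by auto
  then show ?case using filterlim_compose[OF ln_at_top step.IH] by simp
qed

lemma growth_comparison_rel_modulus:
  assumes "0 \<le> p" "0 \<le> q" "0 \<le> m" "vvds f" "vvds g" "vvds h"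
  shows "growth_comparison (iter_log (q - 1)) (\<lambda>x. iter_log (m - 1) (rel_modulus h g x))
    (iter_log (p - 1)) (rel_modulus g f)"
proof
  show "filterlim (\<lambda>x. iter_log (m - 1) (rel_modulus h g x)) at_top at_top"
    by (rule filterlim_compose[OF iter_log_at_top rel_modulus_at_top]) (use assms in auto)
  show "\<forall>\<^sub>F x in at_top. \<exists>\<sigma>\<ge>S. rel_modulus g f \<sigma> = x" for S
    by (rule rel_modulus_attains) (use assms in auto)
qed (use assms in \<open>auto intro: iter_log_at_top rel_modulus_at_top\<close>)

theorem theorem3:
  fixes f g h :: "complex \<Rightarrow> 'a::complex_banach"
    and p q m :: int
  assumes "0 \<le> p" and "0 \<le> q" and "0 \<le> m"
    and "vvds f" and "vvds g" and "vvds h"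
    and "rel_index_pair h f m q" and "rel_index_pair h g m p"
    and "0 < rel_lower_order h f m q" and "rel_lower_order h f m q < \<infinity>"
    and "0 < rel_lower_order h g m p" and "rel_lower_order h g m p < \<infinity>"
    and "0 < rel_order h g m p" and "rel_order h g m p < \<infinity>"
    and "0 < rel_lower_order g f p q" and "rel_lower_order g f p q < \<infinity>"
    and "quotient_meaningful (rel_weak_type h f m q) (rel_weak_indicator h g m p)"
    and "quotient_meaningful (rel_weak_type h f m q) (rel_lower_type h g m p)"
    and "quotient_meaningful (rel_weak_indicator h f m q) (rel_type h g m p)"
  shows "ereal_powr (rel_weak_type h f m q / rel_weak_indicator h g m p)
             (1 / real_of_ereal (rel_lower_order h g m p))
           \<le> rel_weak_type g f p q \<and>
         rel_weak_type g f p q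
           \<le> min (ereal_powr (rel_weak_type h f m q / rel_lower_type h g m p)
                    (1 / real_of_ereal (rel_order h g m p)))
                 (ereal_powr (rel_weak_indicator h f m q / rel_type h g m p)
                    (1 / real_of_ereal (rel_order h g m p)))"
proof -
  \<comment> \<open>All indices are one below those of the orders: \<open>s\<close>,
    \<open>v\<close>, \<open>w\<close> enter the types, and their logarithms enter the
    orders.\<close>
  define s where "s = iter_log (q - 1)"
  define v where "v = (\<lambda>x. iter_log (m - 1) (rel_modulus h g x))"
  define w where "w = iter_log (p - 1)"
  define R where "R = rel_modulus g f"
  interpret growth_comparison s v w R
    unfolding s_def v_def w_def R_def using assms(1-6) by (rule growth_comparison_rel_modulus)
  obtain lf where lf: "rel_lower_order h f m q = ereal lf" "0 < lf"
    using assms(9,10) by (cases "rel_lower_order h f m q") auto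
  obtain lg where lg: "rel_lower_order h g m p = ereal lg" "0 < lg"
    using assms(11,12) by (cases "rel_lower_order h g m p") auto
  obtain rg where rg: "rel_order h g m p = ereal rg" "0 < rg"
    using assms(13,14) by (cases "rel_order h g m p") auto
  obtain l where l: "rel_lower_order g f p q = ereal l" "0 < l"
    using assms(15,16) by (cases "rel_lower_order g f p q") auto
  \<comment> \<open>The growth of f relative to h factors through g, but only eventually; the limits
    below do not see the difference.\<close>
  have vR: "\<forall>\<^sub>F \<sigma> in at_top. iter_log (m - 1) (rel_modulus h f \<sigma>) = v (R \<sigma>)"
    using rel_modulus_compose[OF assms(4,5), of h] by eventually_elim (simp add: v_def R_def)
  note ln_simps = iter_log_eq_ln[OF assms(1)] iter_log_eq_ln[OF assms(2)] iter_log_eq_ln[OF assms(3)]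
  have Lf: "Liminf at_top (\<lambda>\<sigma>. ereal (ln (v (R \<sigma>)) / ln (s \<sigma>))) = ereal lf"
    unfolding lf(1)[symmetric] rel_lower_order_def ln_simps
    by (rule Liminf_eq) (use vR in eventually_elim, simp add: s_def)
  have Lg: "Liminf at_top (\<lambda>x. ereal (ln (v x) / ln (w x))) = ereal lg"
    unfolding lg(1)[symmetric] rel_lower_order_def ln_simps v_def w_def ..
  have Rg: "Limsup at_top (\<lambda>x. ereal (ln (v x) / ln (w x))) = ereal rg"
    unfolding rg(1)[symmetric] rel_order_def ln_simps v_def w_def ..
  have L: "Liminf at_top (\<lambda>\<sigma>. ereal (ln (w (R \<sigma>)) / ln (s \<sigma>))) = ereal l"
    unfolding l(1)[symmetric] rel_lower_order_def ln_simps w_def s_def R_def ..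
  \<comment> \<open>These two inequalities allow the exponent \<open>lf\<close> of \<open>s\<close>
    to be replaced by \<open>lg * l\<close> in the lower bound and by \<open>rg * l\<close> in the
    upper bounds.\<close>
  have le: "lg * l \<le> lf" by (rule lower_order_ge[OF Lf Lg L lf(2) lg(2)])
  have ge: "lf \<le> rg * l" by (rule lower_order_le[OF Lf Rg L rg(2) l(2)])
  have Tf: "rel_weak_type h f m q = Liminf at_top (\<lambda>\<sigma>. ereal (v (R \<sigma>) / s \<sigma> powr lf))"
    unfolding rel_weak_type_def lf(1)
    by (rule Liminf_eq) (use vR in eventually_elim, simp add: s_def)
  have Tf': "rel_weak_indicator h f m q = Limsup at_top (\<lambda>\<sigma>. ereal (v (R \<sigma>) / s \<sigma> powr lf))"
    unfolding rel_weak_indicator_def lf(1)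
    by (rule Limsup_eq) (use vR in eventually_elim, simp add: s_def)
  have Tg: "rel_weak_indicator h g m p = Limsup at_top (\<lambda>x. ereal (v x / w x powr lg))"
    by (simp add: rel_weak_indicator_def lg(1) v_def w_def)
  have Dg: "rel_lower_type h g m p = Liminf at_top (\<lambda>x. ereal (v x / w x powr rg))"
    by (simp add: rel_lower_type_def rg(1) v_def w_def)
  have Dg': "rel_type h g m p = Limsup at_top (\<lambda>x. ereal (v x / w x powr rg))"
    by (simp add: rel_type_def rg(1) v_def w_def)
  have T: "rel_weak_type g f p q = Liminf at_top (\<lambda>\<sigma>. ereal (w (R \<sigma>) / s \<sigma> powr l))"
    by (simp add: rel_weak_type_def l(1) w_def s_def R_def)
  show ?thesis
    using weak_type_lower_bound[OF lg(2) le assms(17)[unfolded Tf Tg]]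
      weak_type_upper_bound_lower_type[OF rg(2) ge assms(18)[unfolded Tf Dg]]
      weak_type_upper_bound_type[OF rg(2) ge assms(19)[unfolded Tf' Dg']]
    by (simp add: Tf Tf' Tg Dg Dg' T lg(1) rg(1))
qed

end
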